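(* Let $N\ge1$. For a polynomial $P_N$ of degree $N$ with zeros $x_1,\dots,x_N$ (with multiplicity), let $m_r(N)=\frac1N\sum_{i}x_i^r$ and $G(N,z)=\sum_{r=0}^\infty m_r(N)z^r$, so $G(N,z)=\frac1N\sum_i\frac{1}{1-zx_i}$. Then for all complex $z$ with $0<|z|<1$ and $|z|\max_i|x_i|<1$ one has, for the classical orthogonal polynomials: (Jacobi $P_N^{(\alpha,\beta)}$, $\alpha,\beta>-1$) $$G^{(\alpha,\beta)}(N,z)=\frac{N+\alpha+\beta+1}{2(\alpha+1)}\,\frac1z\,\frac{{}_2F_1\bigl(-N+1,N+\alpha+\beta+2,\alpha+2;\frac{z-1}{2z}\bigr)}{{}_2F_1\bigl(-N,N+\alpha+\beta+1,\alpha+1;\frac{z-1}{2z}\bigr)};$$ (Chebyshev, first kind, $T_N$) $$G^{(T)}(N,z)=\frac{1}{\sqrt{1-z^2}}\tanh\left(N\ln\frac{z}{1-\sqrt{1-z^2}}\right);$$ (Chebyshev, second kind, $U_N$) $$G^{(U)}(N,z)=\frac{1}{\sqrt{1-z^2}}\left\{\Bigl(1+\frac1N\Bigr)\coth\left((N+1)\ln\frac{z}{1-\sqrt{1-z^2}}\right)-\frac1N\frac{1}{\sqrt{1-z^2}}\right\};$$ (generalized Laguerre $L_N^{(\alpha)}$, $\alpha>-1$) $$G^{(\alpha)}(N,z)=1-\frac{F(-N+1,\alpha+1;1/z)}{F(-N,\alpha+1;1/z)};$$ (Hermite $H_N$) $$G^{(H)}(N,z)=\frac1z\,\frac{F\bigl(-\frac{N-1}{2},\frac12;\frac1{z^2}\bigr)/\Gamma\bigl(\frac{2-N}{2}\bigr)-\frac2z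 F\bigl(\frac{2-N}{2},\frac32;\frac1{z^2}\bigr)/\Gamma\bigl(\frac{1-N}{2}\bigr)}{F\bigl(-\frac N2,\frac12;\frac1{z^2}\bigr)/\Gamma\bigl(\frac{1-N}{2}\bigr)-\frac2z F\bigl(\frac{1-N}{2},\frac32;\frac1{z^2}\bigr)/\Gamma\bigl(-\frac N2\bigr)}.$$
   Context: The polynomials have their standard definitions (Hermite polynomials are the physicists' ones, orthogonal with respect to $e^{-x^2}$). ${}_2F_1(a,b,c;x)$ is the Gauss hypergeometric function and $F(a,c;x)={}_1F_1(a,c;x)$ is the confluent hypergeometric function. $1/\Gamma$ is the entire reciprocal Gamma function, i.e. $1/\Gamma(s)=0$ for $s\in\{0,-1,-2,\dots\}$; a term whose factor $1/\Gamma$ vanishes is $0$. The square root is the principal one; the values of $\tanh$ and $\coth$ do not depend on the branch of $\ln$. *)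

theory Defs
  imports "HOL-Analysis.Analysis"
begin

section \<open>Zeros of a polynomial\<close>

definition mean_power :: "complex poly \<Rightarrow> nat \<Rightarrow> complex" where
  "mean_power P r = (\<Sum>x\<in>#proots P. x ^ r) / of_nat (degree P)"

definition moment_gf :: "complex poly \<Rightarrow> complex \<Rightarrow> complex" where
  "moment_gf P z = (\<Sum>r. mean_power P r * z ^ r)"

definition max_zero_norm :: "complex poly \<Rightarrow> real" where
  "max_zero_norm P = Max {cmod x | x. poly P x = 0}"


section \<open>Special functions\<close>

text \<open>Both are the sums of the defining series. The series for \<open>hyp2F1\<close> is summable for all \<open>x\<close>
  only if \<open>a\<close> or \<open>b\<close> is a non-positive integer.\<close>

definition hyp2F1 :: "complex \<Rightarrow> complex \<Rightarrow> complex \<Rightarrow> complex \<Rightarrow> complex" where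
  "hyp2F1 a b c x = eval_fps (fps_hypergeo [a, b] [c] 1) x"

definition hyp1F1 :: "complex \<Rightarrow> complex \<Rightarrow> complex \<Rightarrow> complex" where
  "hyp1F1 a c x = eval_fps (fps_hypergeo [a] [c] 1) x"

definition coth :: "complex \<Rightarrow> complex" where
  "coth x = cosh x / sinh x"


section \<open>The classical orthogonal polynomials\<close>

text \<open>The Jacobi polynomials are given by
  \<open>\<Sum>s\<le>n. (n + a choose n - s) (n + b choose s) ((x - 1) / 2)^s ((x + 1) / 2)^(n - s)\<close>;
  this is what the Leibniz rule makes of the Rodrigues formula, see \<open>jacobi_rodrigues\<close> below.
  In the same way the Laguerre polynomials are tied to \<open>laguerre_rodrigues\<close>.\<close>

definition jacobi :: "'a::field_char_0 \<Rightarrow> 'a \<Rightarrow> nat \<Rightarrow> 'a poly" where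
  "jacobi a b n = (\<Sum>s\<le>n. smult (((of_nat n + a) gchoose (n - s)) * ((of_nat n + b) gchoose s))
      ([:- 1 / 2, 1 / 2:] ^ s * [:1 / 2, 1 / 2:] ^ (n - s)))"

definition laguerre :: "'a::field_char_0 \<Rightarrow> nat \<Rightarrow> 'a poly" where
  "laguerre a n = (\<Sum>k\<le>n. monom ((- 1) ^ k * ((of_nat n + a) gchoose (n - k)) / fact k) k)"

fun chebyshev_T :: "nat \<Rightarrow> 'a::comm_ring_1 poly" where
  "chebyshev_T 0 = 1"
| "chebyshev_T (Suc 0) = [:0, 1:]"
| "chebyshev_T (Suc (Suc n)) = [:0, 2:] * chebyshev_T (Suc n) - chebyshev_T n"

fun chebyshev_U :: "nat \<Rightarrow> 'a::comm_ring_1 poly" where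
  "chebyshev_U 0 = 1"
| "chebyshev_U (Suc 0) = [:0, 2:]"
| "chebyshev_U (Suc (Suc n)) = [:0, 2:] * chebyshev_U (Suc n) - chebyshev_U n"

fun hermite :: "nat \<Rightarrow> 'a::comm_ring_1 poly" where
  "hermite 0 = 1"
| "hermite (Suc 0) = [:0, 2:]"
| "hermite (Suc (Suc n)) = [:0, 2:] * hermite (Suc n) - smult (2 * of_nat (Suc n)) (hermite n)"


section \<open>Agreement with the other usual definitions\<close>

lemma chebyshev_T_cos: "poly (chebyshev_T n) (cos t :: real) = cos (real n * t)"
proof (induction n rule: chebyshev_T.induct)
  case (3 n)
  have "cos (real (Suc (Suc n)) * t) + cos (real n * t) = 2 * cos t * cos (real (Suc n) * t)"
    using cos_add[of "real (Suc n) * t" t] cos_diff[of "real (Suc n) * t" t]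
    by (simp add: algebra_simps)
  with 3 show ?case by (simp add: algebra_simps)
qed auto

lemma chebyshev_U_sin: "poly (chebyshev_U n) (cos t :: real) * sin t = sin (real (Suc n) * t)"
proof (induction n rule: chebyshev_U.induct)
  case 2
  show ?case using sin_double[of t] by (simp add: algebra_simps)
next
  case (3 n)
  have "sin (real (Suc (Suc (Suc n))) * t) + sin (real (Suc n) * t)
      = 2 * cos t * sin (real (Suc (Suc n)) * t)"
    using sin_add[of "real (Suc (Suc n)) * t" t] sin_diff[of "real (Suc (Suc n)) * t" t]
    by (simp add: algebra_simps)
  moreover have "poly (chebyshev_U (Suc (Suc n))) (cos t) * sin t
      = 2 * cos t * (poly (chebyshev_U (Suc n)) (cos t) * sin t) - poly (chebyshev_U n) (cos t) * sin t"
    by (simp add: algebra_simps)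
  ultimately show ?case using 3 by simp
qed auto

lemma pderiv_hermite: "pderiv (hermite (Suc n) :: real poly) = smult (2 * real (Suc n)) (hermite n)"
proof (induction n rule: less_induct)
  case (less n)
  show ?case
  proof (cases n)
    case 0
    then show ?thesis by (simp add: pderiv_pCons)
  next
    case (Suc m)
    have 1: "pderiv (hermite (Suc m) :: real poly) = smult (2 * real (Suc m)) (hermite m)"
      using less[of m] Suc by simp
    have 2: "hermite (Suc m) = [:0, 2:] * (hermite m :: real poly) - pderiv (hermite m)"
    proof (cases m)
      case (Suc l)
      then show ?thesis using less[of l] \<open>n = Suc m\<close> by simp
    qed simp
    show ?thesis
      unfolding Suc hermite.simps(3) pderiv_diff pderiv_mult pderiv_smult 1
      by (rule poly_ext) (simp add: 2 pderiv_pCons algebra_simps)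
  qed
qed

lemma hermite_Suc: "hermite (Suc n) = [:0, 2:] * (hermite n :: real poly) - pderiv (hermite n)"
proof (cases n)
  case (Suc m)
  then show ?thesis by (simp add: pderiv_hermite)
qed simp

lemma hermite_rodrigues:
  "(deriv ^^ n) (\<lambda>t::real. exp (- t\<^sup>2)) x = (- 1) ^ n * exp (- x\<^sup>2) * poly (hermite n) x"
proof (induction n arbitrary: x)
  case (Suc n)
  have "(deriv ^^ n) (\<lambda>t::real. exp (- t\<^sup>2)) = (\<lambda>x. (- 1) ^ n * exp (- x\<^sup>2) * poly (hermite n) x)"
    by (rule ext) (rule Suc)
  moreover have "((\<lambda>x::real. (- 1) ^ n * exp (- x\<^sup>2) * poly (hermite n) x) has_field_derivative
      (- 1) ^ Suc n * exp (- x\<^sup>2) * poly (hermite (Suc n)) x) (at x)"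
    by (auto intro!: derivative_eq_intros poly_DERIV simp: hermite_Suc algebra_simps)
  ultimately show ?case by (simp add: DERIV_imp_deriv)
qed simp

lemma higher_deriv_mult_real:
  fixes F G :: "nat \<Rightarrow> real \<Rightarrow> real"
  assumes "open S" "x \<in> S"
    and F: "\<And>k t. t \<in> S \<Longrightarrow> (F k has_field_derivative F (Suc k) t) (at t)"
    and G: "\<And>k t. t \<in> S \<Longrightarrow> (G k has_field_derivative G (Suc k) t) (at t)"
  shows "(deriv ^^ n) (\<lambda>t. F 0 t * G 0 t) x = (\<Sum>k\<le>n. real (n choose k) * F k x * G (n - k) x)"
  using \<open>x \<in> S\<close>
proof (induction n arbitrary: x)
  case (Suc n)
  let ?s = "\<lambda>t. \<Sum>k\<le>n. real (n choose k) * F k t * G (n - k) t"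
  have "\<forall>\<^sub>F t in nhds x. (deriv ^^ n) (\<lambda>t. F 0 t * G 0 t) t = ?s t"
    using eventually_nhds_in_open[OF \<open>open S\<close> Suc.prems] by eventually_elim (rule Suc.IH)
  then have "deriv ((deriv ^^ n) (\<lambda>t. F 0 t * G 0 t)) x = deriv ?s x"
    by (rule deriv_cong_ev) simp
  also have "\<dots> = (\<Sum>k\<le>n. real (n choose k) * (F (Suc k) x * G (n - k) x + F k x * G (Suc (n - k)) x))"
    by (intro DERIV_imp_deriv)
      (auto intro!: derivative_eq_intros F[OF Suc.prems] G[OF Suc.prems] sum.cong simp: algebra_simps)
  also have "\<dots> = (\<Sum>k\<le>n. real (n choose k) * F (Suc k) x * G (n - k) x)
      + (\<Sum>k\<le>n. real (n choose k) * F k x * G (Suc n - k) x)"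
    by (simp add: algebra_simps sum.distrib Suc_diff_le)
  also have "(\<Sum>k\<le>n. real (n choose k) * F k x * G (Suc n - k) x)
      = (\<Sum>k\<le>Suc n. real (n choose k) * F k x * G (Suc n - k) x)"
    by simp
  also have "\<dots> = F 0 x * G (Suc n) x
      + (\<Sum>k\<le>n. real (n choose Suc k) * F (Suc k) x * G (n - k) x)"
    by (subst sum.atMost_Suc_shift) simp
  also have "(\<Sum>k\<le>n. real (n choose k) * F (Suc k) x * G (n - k) x) + \<dots>
      = (\<Sum>k\<le>Suc n. real (Suc n choose k) * F k x * G (Suc n - k) x)"
    by (subst sum.atMost_Suc_shift) (simp add: algebra_simps sum.distrib)
  finally show ?case by simp
qed simp

lemma gbinomial_fact_Suc: "fact (Suc k) * (c gchoose Suc k) = (c - real k) * (fact k * (c gchoose k))"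
  unfolding gbinomial_mult_fact by (simp add: atLeast0_lessThan_Suc)

lemma falling_powr_derivs:
  fixes c t :: real
  shows "t > -1 \<Longrightarrow> ((\<lambda>t. fact k * (c gchoose k) * (1 + t) powr (c - real k)) has_field_derivative
      fact (Suc k) * (c gchoose Suc k) * (1 + t) powr (c - real (Suc k))) (at t)"
    and "t < 1 \<Longrightarrow> ((\<lambda>t. (- 1) ^ k * (fact k * (c gchoose k)) * (1 - t) powr (c - real k)) has_field_derivative
      (- 1) ^ Suc k * (fact (Suc k) * (c gchoose Suc k)) * (1 - t) powr (c - real (Suc k))) (at t)"
    and "t > 0 \<Longrightarrow> ((\<lambda>t. fact k * (c gchoose k) * t powr (c - real k)) has_field_derivative
      fact (Suc k) * (c gchoose Suc k) * t powr (c - real (Suc k))) (at t)"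
proof -
  have e: "c - real (Suc k) = c - real k - 1" by simp
  have p: "((\<lambda>t. t powr (c - real k)) has_field_derivative (c - real k) * u powr (c - real k - 1)) (at u)"
    if "u > 0" for u using that by (rule has_real_derivative_powr)
  show "((\<lambda>t. fact k * (c gchoose k) * (1 + t) powr (c - real k)) has_field_derivative
      fact (Suc k) * (c gchoose Suc k) * (1 + t) powr (c - real (Suc k))) (at t)" if "t > -1"
  proof -
    have "((\<lambda>t. (1 + t) powr (c - real k)) has_field_derivative
        (c - real k) * (1 + t) powr (c - real k - 1) * 1) (at t)"
      by (rule DERIV_chain2[OF p]) (use that in \<open>auto intro!: derivative_eq_intros\<close>)
    from DERIV_cmult[OF this, of "fact k * (c gchoose k)"] show ?thesis
      unfolding gbinomial_fact_Suc e by (simp only: mult_1_left mult_1_right mult_ac)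
  qed
  show "((\<lambda>t. (- 1) ^ k * (fact k * (c gchoose k)) * (1 - t) powr (c - real k)) has_field_derivative
      (- 1) ^ Suc k * (fact (Suc k) * (c gchoose Suc k)) * (1 - t) powr (c - real (Suc k))) (at t)" if "t < 1"
  proof -
    have "((\<lambda>t. (1 - t) powr (c - real k)) has_field_derivative
        (c - real k) * (1 - t) powr (c - real k - 1) * (- 1)) (at t)"
      by (rule DERIV_chain2[OF p]) (use that in \<open>auto intro!: derivative_eq_intros\<close>)
    from DERIV_cmult[OF this, of "(- 1) ^ k * (fact k * (c gchoose k))"] show ?thesis
      unfolding gbinomial_fact_Suc e power_Suc by (simp only: mult_ac)
  qed
  show "((\<lambda>t. fact k * (c gchoose k) * t powr (c - real k)) has_field_derivative
      fact (Suc k) * (c gchoose Suc k) * t powr (c - real (Suc k))) (at t)" if "t > 0"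
    using DERIV_cmult[OF p[OF that], of "fact k * (c gchoose k)"]
    unfolding gbinomial_fact_Suc e by (simp only: mult_ac)
qed

lemma jacobi_rodrigues:
  fixes a b x :: real
  assumes "-1 < x" "x < 1"
  shows "(deriv ^^ n) (\<lambda>t. (1 - t) powr (real n + a) * (1 + t) powr (real n + b)) x
    = (- 1) ^ n * 2 ^ n * fact n * (1 - x) powr a * (1 + x) powr b * poly (jacobi a b n) x"
proof -
  define F where "F k t = (- 1) ^ k * (fact k * ((real n + a) gchoose k))
    * (1 - t) powr (real n + a - real k)" for k t
  define G where "G k t = (fact k * ((real n + b) gchoose k)) * (1 + t) powr (real n + b - real k)" for k t
  have F: "(F k has_field_derivative F (Suc k) t) (at t)" if "t \<in> {-1<..<1}" for k t
    unfolding F_def using falling_powr_derivs(2) that by simp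
  have G: "(G k has_field_derivative G (Suc k) t) (at t)" if "t \<in> {-1<..<1}" for k t
    unfolding G_def using falling_powr_derivs(1) that by simp
  have "(deriv ^^ n) (\<lambda>t. F 0 t * G 0 t) x = (\<Sum>k\<le>n. real (n choose k) * F k x * G (n - k) x)"
    by (rule higher_deriv_mult_real[of "{-1<..<1}"]) (use assms F G in auto)
  also have "\<dots> = (\<Sum>s\<le>n. real (n choose (n - s)) * F (n - s) x * G s x)"
    by (rule sum.reindex_bij_witness[of _ "\<lambda>k. n - k" "\<lambda>k. n - k"]) auto
  also have "\<dots> = (\<Sum>s\<le>n. (- 1) ^ n * 2 ^ n * fact n * (1 - x) powr a * (1 + x) powr b *
     ((((real n + a) gchoose (n - s)) * ((real n + b) gchoose s)) *
      (((x - 1) / 2) ^ s * ((x + 1) / 2) ^ (n - s))))"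
  proof (rule sum.cong[OF refl])
    fix s assume "s \<in> {..n}"
    then have s: "s \<le> n" by simp
    have 1: "real (n choose (n - s)) * fact (n - s) * fact s = fact n"
      using binomial_fact_lemma[OF s] s
      by (metis (mono_tags, lifting) binomial_symmetric mult.assoc mult.commute of_nat_fact of_nat_mult)
    have 2: "(1 - x) powr (real n + a - real (n - s)) = (1 - x) powr a * (1 - x) ^ s"
      using s assms by (simp add: of_nat_diff powr_add powr_realpow)
    have 3: "(1 + x) powr (real n + b - real s) = (1 + x) powr b * (1 + x) ^ (n - s)"
    proof -
      have "real n + b - real s = b + real (n - s)"
        using s by (simp add: of_nat_diff)
      moreover have "(1 + x) powr (b + real (n - s)) = (1 + x) powr b * (1 + x) ^ (n - s)"
        unfolding powr_add using assms by (subst powr_realpow) auto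
      ultimately show ?thesis by (rule ssubst)
    qed
    have 4: "(- 1) ^ n * 2 ^ n * (((x - 1) / 2) ^ s * ((x + 1) / 2) ^ (n - s))
        = (- 1) ^ (n - s) * (1 - x) ^ s * (1 + x) ^ (n - s)"
    proof -
      have e: "c ^ n = c ^ s * c ^ (n - s)" for c :: real
        using s by (simp add: power_add[symmetric])
      have "(- 1) ^ n * 2 ^ n * (((x - 1) / 2) ^ s * ((x + 1) / 2) ^ (n - s))
          = ((- 1) * 2 * ((x - 1) / 2)) ^ s * ((- 1) * 2 * ((x + 1) / 2)) ^ (n - s)"
        unfolding e power_mult_distrib by (simp add: mult_ac)
      also have "(- 1) * 2 * ((x - 1) / 2) = 1 - x" by simp
      also have "(- 1) * 2 * ((x + 1) / 2) = (- 1) * (1 + x)" by simp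
      finally show ?thesis unfolding power_mult_distrib by (simp add: mult_ac)
    qed
    have "real (n choose (n - s)) * F (n - s) x * G s x
      = (real (n choose (n - s)) * fact (n - s) * fact s)
        * ((real n + a) gchoose (n - s)) * ((real n + b) gchoose s)
        * ((1 - x) powr a * (1 + x) powr b)
        * ((- 1) ^ (n - s) * (1 - x) ^ s * (1 + x) ^ (n - s))"
      unfolding F_def G_def 2 3 by (simp add: mult_ac)
    also have "\<dots> = (- 1) ^ n * 2 ^ n * fact n * (1 - x) powr a * (1 + x) powr b *
     ((((real n + a) gchoose (n - s)) * ((real n + b) gchoose s)) *
      (((x - 1) / 2) ^ s * ((x + 1) / 2) ^ (n - s)))"
      unfolding 1 4[symmetric] by (simp add: mult_ac)
    finally show "real (n choose (n - s)) * F (n - s) x * G s x = \<dots>" .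
  qed
  also have "\<dots> = (- 1) ^ n * 2 ^ n * fact n * (1 - x) powr a * (1 + x) powr b * poly (jacobi a b n) x"
    unfolding sum_distrib_left[symmetric]
    by (simp add: jacobi_def poly_sum diff_divide_distrib add_divide_distrib add.commute)
  finally show ?thesis by (simp add: F_def G_def)
qed

lemma laguerre_rodrigues:
  fixes a x :: real
  assumes "0 < x"
  shows "(deriv ^^ n) (\<lambda>t. exp (- t) * t powr (real n + a)) x
    = fact n * exp (- x) * x powr a * poly (laguerre a n) x"
proof -
  define F where "F k t = (- 1) ^ k * exp (- t)" for k and t :: real
  define G where "G k t = (fact k * ((real n + a) gchoose k)) * t powr (real n + a - real k)" for k t
  have F: "(F k has_field_derivative F (Suc k) t) (at t)" for k t
    unfolding F_def by (auto intro!: derivative_eq_intros)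
  have G: "(G k has_field_derivative G (Suc k) t) (at t)" if "t \<in> {0<..}" for k t
    unfolding G_def using falling_powr_derivs(3) that by simp
  have "(deriv ^^ n) (\<lambda>t. F 0 t * G 0 t) x = (\<Sum>k\<le>n. real (n choose k) * F k x * G (n - k) x)"
    by (rule higher_deriv_mult_real[of "{0<..}"]) (use assms F G in auto)
  also have "\<dots> = (\<Sum>k\<le>n. fact n * exp (- x) * x powr a *
      ((- 1) ^ k * ((real n + a) gchoose (n - k)) / fact k * x ^ k))"
  proof (rule sum.cong[OF refl])
    fix k assume "k \<in> {..n}"
    then have k: "k \<le> n" by simp
    have 1: "real (n choose k) * fact (n - k) = fact n / fact k"
      using k by (simp add: binomial_fact)
    have 2: "x powr (real n + a - real (n - k)) = x powr a * x ^ k"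
      using k assms by (simp add: of_nat_diff powr_add powr_realpow)
    have "real (n choose k) * F k x * G (n - k) x
      = (real (n choose k) * fact (n - k)) * ((- 1) ^ k * ((real n + a) gchoose (n - k)))
        * exp (- x) * (x powr a * x ^ k)"
      unfolding F_def G_def 2 by (simp add: mult_ac)
    then show "real (n choose k) * F k x * G (n - k) x = fact n * exp (- x) * x powr a *
      ((- 1) ^ k * ((real n + a) gchoose (n - k)) / fact k * x ^ k)"
      unfolding 1 by (simp add: mult_ac)
  qed
  also have "\<dots> = fact n * exp (- x) * x powr a * poly (laguerre a n) x"
    unfolding sum_distrib_left[symmetric] by (simp add: laguerre_def poly_sum poly_monom)
  finally show ?thesis by (simp add: F_def G_def)
qed

end

theory Submission
  imports Defs "HOL-Computational_Algebra.Fundamental_Theorem_Algebra"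
begin

text \<open>Summing geometric series gives \<open>G(N, z) = w P'(w) / (N P(w))\<close> with \<open>w = 1 / z\<close>, so only \<open>P'(w) / P(w)\<close>
  has to be found. The Jacobi and Laguerre polynomials are terminating hypergeometric series, whose
  derivatives follow from contiguous relations checked coefficientwise. For the Chebyshev polynomials put
  \<open>w = (q + 1 / q) / 2\<close>, where everything becomes a combination of powers of \<open>q\<close>. For the Hermite polynomials
  \<open>H\<^sub>N' = 2 N H\<^sub>N\<^sub>-\<^sub>1\<close>, and for either parity of \<open>N\<close> one of the two reciprocal Gamma factors in the
  confluent representation of \<open>H\<^sub>N\<close> vanishes while the other term is a terminating series.\<close>

section \<open>Moments and the logarithmic derivative\<close>

text \<open>One geometric series per element of \<open>A\<close>, added by induction; the multiset
  keeps multiplicities.\<close>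

lemma sums_power_sums_mset:
  fixes A :: "complex multiset" and z :: complex
  assumes "\<And>x. x \<in># A \<Longrightarrow> cmod (z * x) < 1"
  shows "(\<lambda>r. (\<Sum>x\<in>#A. x ^ r) * z ^ r) sums (\<Sum>x\<in>#A. 1 / (1 - z * x))"
  using assms
proof (induction A)
  case (add x A)
  have "(\<lambda>r. (z * x) ^ r) sums (1 / (1 - z * x))"
    using add.prems by (intro geometric_sums) auto
  from sums_add[OF this add.IH] add.prems show ?case
    by (simp add: algebra_simps power_mult_distrib)
qed simp

text \<open>The product rule as a logarithmic derivative; induction over a multiset treats repeated
  and simple zeros alike.\<close>

lemma poly_pderiv_prod_mset:
  fixes w :: "'a :: field"
  assumes "w \<notin># A"
  shows "poly (pderiv (\<Prod>x\<in>#A. [:- x, 1:])) w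
    = poly (\<Prod>x\<in>#A. [:- x, 1:]) w * (\<Sum>x\<in>#A. 1 / (w - x))"
  using assms by (induction A) (auto simp: pderiv_mult pderiv_pCons field_simps simp del: mult_pCons_left)

text \<open>Over the complex numbers \<open>P\<close> splits into linear factors, and the leading
  coefficient cancels in the quotient.\<close>

lemma sum_proots_inverse_diff:
  fixes w :: complex
  assumes "poly P w \<noteq> 0"
  shows "(\<Sum>x\<in>#proots P. 1 / (w - x)) = poly (pderiv P) w / poly P w"
proof -
  let ?Q = "\<Prod>x\<in>#proots P. [:- x, 1:]"
  have P: "P = smult (lead_coeff P) ?Q"
    by (rule complex_poly_decompose_multiset [symmetric])
  have "P \<noteq> 0" using assms by auto
  then have "w \<notin># proots P" using assms by simp
  from poly_pderiv_prod_mset[OF this]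
  have "poly (pderiv P) w = poly P w * (\<Sum>x\<in>#proots P. 1 / (w - x))"
    using arg_cong[OF P, of "\<lambda>p. poly p w"] arg_cong[OF P, of "\<lambda>p. poly (pderiv p) w"]
    by (simp only: pderiv_smult poly_smult mult.assoc)
  with assms show ?thesis by simp
qed

text \<open>Positive degree makes the zero set finite, so the \<open>Max\<close> in
  \<open>max_zero_norm\<close> really bounds every zero.\<close>

lemma zeros_in_disc:
  assumes "degree P \<ge> 1" "cmod z * max_zero_norm P < 1" "poly P x = 0"
  shows "cmod (z * x) < 1"
proof -
  have "finite {x. poly P x = 0}"
    using assms(1) by (intro poly_roots_finite) auto
  then have "cmod x \<le> max_zero_norm P"
    unfolding max_zero_norm_def setcompr_eq_image using assms(3) by (intro Max_ge) auto
  then have "cmod z * cmod x \<le> cmod z * max_zero_norm P"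
    by (intro mult_left_mono) auto
  with assms(2) show ?thesis by (simp add: norm_mult)
qed

lemma moment_gf_sums:
  assumes "degree P = N" "N \<ge> 1" "cmod z * max_zero_norm P < 1"
  shows "(\<lambda>r. mean_power P r * z ^ r) sums (1 / of_nat N * (\<Sum>x\<in>#proots P. 1 / (1 - z * x)))"
proof -
  have "P \<noteq> 0" using assms by auto
  then have "(\<lambda>r. (\<Sum>x\<in>#proots P. x ^ r) * z ^ r) sums (\<Sum>x\<in>#proots P. 1 / (1 - z * x))"
    using assms by (intro sums_power_sums_mset zeros_in_disc[of P]) auto
  from sums_divide[OF this, of "of_nat N"] show ?thesis
    by (simp add: mean_power_def assms(1) field_simps)
qed

lemma poly_nonzero_at_inverse:
  assumes "degree P = N" "N \<ge> 1" "cmod z * max_zero_norm P < 1" "z \<noteq> 0"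
  shows "poly P (1 / z) \<noteq> 0"
  using zeros_in_disc[of P z "1 / z"] assms by auto

text \<open>The entry point for all five families: only the logarithmic derivative at
  \<open>1 / z\<close> remains to be computed, and constant factors of \<open>P\<close> cancel in
  it.\<close>

lemma moment_gf_log_deriv:
  assumes "degree P = N" "N \<ge> 1" "cmod z * max_zero_norm P < 1" "z \<noteq> 0"
  shows "moment_gf P z = 1 / (of_nat N * z) * (poly (pderiv P) (1 / z) / poly P (1 / z))"
proof -
  \<comment> \<open>Valid for every \<open>x\<close>: if \<open>z * x = 1\<close>, both sides are 0
    because division by zero yields 0.\<close>
  have "1 / (1 - z * x) = 1 / z * (1 / (1 / z - x))" for x
    using assms(4) by (cases "z * x = 1") (auto simp: field_simps)
  then have "(\<Sum>x\<in>#proots P. 1 / (1 - z * x)) = 1 / z * (\<Sum>x\<in>#proots P. 1 / (1 / z - x))"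
    by (simp only: sum_mset_distrib_left)
  also have "\<dots> = 1 / z * (poly (pderiv P) (1 / z) / poly P (1 / z))"
    by (simp add: sum_proots_inverse_diff[OF poly_nonzero_at_inverse[OF assms]])
  finally show ?thesis
    using sums_unique[OF moment_gf_sums[OF assms(1-3)]] by (simp add: moment_gf_def mult.assoc)
qed

section \<open>Terminating hypergeometric series\<close>

text \<open>The terminating series as a genuine polynomial, so that \<open>pderiv\<close>,
  \<open>degree\<close> and coefficient comparison apply. The numerator parameter
  \<open>- of_nat n\<close>, which causes the termination, is split off.\<close>

definition hyp_poly :: "nat \<Rightarrow> complex list \<Rightarrow> complex list \<Rightarrow> complex poly" where
  "hyp_poly n as bs = (\<Sum>k\<le>n. monom (fps_nth (fps_hypergeo (- of_nat n # as) bs 1) k) k)"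

text \<open>\<open>fps_hypergeo\<close> multiplies its Pochhammer factors by \<open>foldl\<close>;
  once the leading one is 0, the product stays 0.\<close>

lemma foldl_mult_zero: "foldl (\<lambda>r a. r * f a) (0 :: 'a :: comm_ring_1) xs = 0"
  by (induction xs) auto

text \<open>Cutting off at \<open>n\<close> loses nothing, since
  \<open>pochhammer (- of_nat n) k\<close> vanishes for \<open>k > n\<close>. Identities between
  such polynomials can thus be checked uniformly in \<open>k\<close>.\<close>

lemma coeff_hyp_poly: "coeff (hyp_poly n as bs) k = fps_nth (fps_hypergeo (- of_nat n # as) bs 1) k"
proof -
  have "fps_nth (fps_hypergeo (- of_nat n # as) bs 1) k = 0" if "\<not> k \<le> n"
    using that by (simp add: pochhammer_of_nat_eq_0_lemma foldl_mult_zero)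
  moreover have "coeff (hyp_poly n as bs) k
      = (if k \<le> n then fps_nth (fps_hypergeo (- of_nat n # as) bs 1) k else 0)"
    unfolding hyp_poly_def coeff_sum coeff_monom by (subst sum.delta) auto
  ultimately show ?thesis by auto
qed

lemma fps_of_hyp_poly: "fps_of_poly (hyp_poly n as bs) = fps_hypergeo (- of_nat n # as) bs 1"
  by (rule fps_ext) (simp only: fps_of_poly_nth coeff_hyp_poly)

lemma hyp1F1_eq_poly: "hyp1F1 (- of_nat n) c x = poly (hyp_poly n [] [c]) x"
  unfolding hyp1F1_def fps_of_hyp_poly[symmetric] by simp

lemma hyp2F1_eq_poly: "hyp2F1 (- of_nat n) b c x = poly (hyp_poly n [b] [c]) x"
  unfolding hyp2F1_def fps_of_hyp_poly[symmetric] by simp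

lemma coeff_hyp_poly_1F1:
  "coeff (hyp_poly n [] [c]) k = pochhammer (- of_nat n) k / (pochhammer c k * fact k)"
  by (simp add: coeff_hyp_poly)

lemma coeff_hyp_poly_2F1:
  "coeff (hyp_poly n [b] [c]) k
    = pochhammer (- of_nat n) k * pochhammer b k / (pochhammer c k * fact k)"
  by (simp add: coeff_hyp_poly)

lemma degree_hyp_poly_le: "degree (hyp_poly n as bs) \<le> n"
  unfolding hyp_poly_def by (intro degree_sum_le) (auto intro: order.trans[OF degree_monom_le])

lemma degree_hyp_poly_1F1:
  assumes "c \<notin> \<int>\<^sub>\<le>\<^sub>0"
  shows "degree (hyp_poly n [] [c]) = n"
proof (intro antisym degree_hyp_poly_le le_degree)
  show "coeff (hyp_poly n [] [c]) n \<noteq> 0"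
    using assms pochhammer_eq_0_imp_nonpos_Int[of c n]
    by (auto simp: coeff_hyp_poly_1F1 pochhammer_of_nat_eq_0_iff)
qed

lemma degree_hyp_poly_2F1:
  assumes "c \<notin> \<int>\<^sub>\<le>\<^sub>0" "b \<notin> \<int>\<^sub>\<le>\<^sub>0"
  shows "degree (hyp_poly n [b] [c]) = n"
proof (intro antisym degree_hyp_poly_le le_degree)
  show "coeff (hyp_poly n [b] [c]) n \<noteq> 0"
    using assms pochhammer_eq_0_imp_nonpos_Int[of c n] pochhammer_eq_0_imp_nonpos_Int[of b n]
    by (auto simp: coeff_hyp_poly_2F1 pochhammer_of_nat_eq_0_iff)
qed

section \<open>Derivatives and contiguous relations of terminating series\<close>

lemma pochhammer_shift: "a * pochhammer (a + 1) k = (a + of_nat k) * pochhammer (a :: 'a :: comm_ring_1) k"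
  by (rule trans[OF pochhammer_rec[symmetric] pochhammer_rec'])

lemma neg_Suc_plus_1: "- of_nat (Suc n) + 1 = (- of_nat n :: 'a :: comm_ring_1)"
  by simp

text \<open>Each Pochhammer symbol of index \<open>Suc k\<close> releases its first factor and
  shifts its parameter by one; the factor \<open>Suc k\<close> from differentiation cancels against
  the factorial.\<close>

lemma pderiv_hyp_poly_2F1:
  assumes "c \<notin> \<int>\<^sub>\<le>\<^sub>0"
  shows "pderiv (hyp_poly (Suc n) [b] [c])
    = smult (- of_nat (Suc n) * b / c) (hyp_poly n [b + 1] [c + 1])"
proof (rule poly_eqI)
  fix k
  have "pochhammer c (Suc k) \<noteq> 0"
    using assms pochhammer_eq_0_imp_nonpos_Int by blast
  then have "c \<noteq> 0" "pochhammer (c + 1) k \<noteq> 0" by (auto simp: pochhammer_rec)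
  then show "coeff (pderiv (hyp_poly (Suc n) [b] [c])) k
      = coeff (smult (- of_nat (Suc n) * b / c) (hyp_poly n [b + 1] [c + 1])) k"
    unfolding coeff_pderiv coeff_smult coeff_hyp_poly_2F1 pochhammer_rec neg_Suc_plus_1 fact_Suc
    by (simp add: divide_simps del: of_nat_Suc)
qed

text \<open>The operator \<open>x d/dx\<close> multiplies the coefficient of index \<open>k\<close>
  by \<open>k\<close>. With \<open>a = - of_nat (Suc n)\<close> the claim becomes
  \<open>a * pochhammer (a + 1) k = (a + k) * pochhammer a k\<close>.\<close>

lemma X_pderiv_hyp_poly_1F1:
  "[:0, 1:] * pderiv (hyp_poly (Suc n) [] [c])
    = smult (- of_nat (Suc n)) (hyp_poly n [] [c] - hyp_poly (Suc n) [] [c])"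
proof (rule poly_eqI)
  fix k
  have "- of_nat (Suc n) * pochhammer (- of_nat n) k
      = (- of_nat (Suc n) + of_nat k) * pochhammer (- of_nat (Suc n) :: complex) k"
    by (rule pochhammer_shift[of "- of_nat (Suc n)" k, unfolded neg_Suc_plus_1])
  moreover have "coeff ([:0, 1:] * pderiv p) k = of_nat k * coeff p k" for p :: "complex poly"
    by (cases k) (simp_all add: coeff_pderiv)
  ultimately show "coeff ([:0, 1:] * pderiv (hyp_poly (Suc n) [] [c])) k
      = coeff (smult (- of_nat (Suc n)) (hyp_poly n [] [c] - hyp_poly (Suc n) [] [c])) k"
    unfolding coeff_smult coeff_diff coeff_hyp_poly_1F1 right_diff_distrib times_divide_eq_right
    by (simp only: coeff_hyp_poly_1F1 times_divide_eq_right diff_divide_distrib[symmetric]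
        distrib_right add_diff_cancel_left')
qed

text \<open>The contiguous relation \<open>c (F(a+1; c) - F(a; c)) = x F(a+1; c+1)\<close> with
  \<open>a = - of_nat (Suc n)\<close>. In degree \<open>Suc j\<close> the two Pochhammer symbols
  share the factor \<open>pochhammer (- of_nat n) j\<close>, and the cofactors differ by
  \<open>Suc j\<close>.\<close>

lemma hyp_poly_1F1_lower_numerator:
  assumes "c \<notin> \<int>\<^sub>\<le>\<^sub>0"
  shows "smult c (hyp_poly n [] [c] - hyp_poly (Suc n) [] [c]) = [:0, 1:] * hyp_poly n [] [c + 1]"
proof (rule poly_eqI)
  fix k
  show "coeff (smult c (hyp_poly n [] [c] - hyp_poly (Suc n) [] [c])) k
      = coeff ([:0, 1:] * hyp_poly n [] [c + 1]) k"
  proof (cases k)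
    case (Suc j)
    have "pochhammer c (Suc j) \<noteq> 0"
      using assms pochhammer_eq_0_imp_nonpos_Int by blast
    then have nz: "c \<noteq> 0" "pochhammer (c + 1) j \<noteq> 0" by (auto simp: pochhammer_rec)
    have 1: "pochhammer (- of_nat n) (Suc j) = (- of_nat n + of_nat j) * pochhammer (- of_nat n :: complex) j"
      by (rule pochhammer_rec')
    have 2: "pochhammer (- of_nat (Suc n)) (Suc j) = - of_nat (Suc n) * pochhammer (- of_nat n :: complex) j"
      by (simp only: pochhammer_rec neg_Suc_plus_1)
    have "pochhammer (- of_nat n) (Suc j) - pochhammer (- of_nat (Suc n)) (Suc j)
       = of_nat (Suc j) * pochhammer (- of_nat n :: complex) j"
      unfolding 1 2 by (simp add: algebra_simps)
    then have "coeff (smult c (hyp_poly n [] [c] - hyp_poly (Suc n) [] [c])) k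
        = c * (of_nat (Suc j) * pochhammer (- of_nat n) j
          / ((c * pochhammer (c + 1) j) * (of_nat (Suc j) * fact j)))"
      unfolding Suc coeff_smult coeff_diff coeff_hyp_poly_1F1 diff_divide_distrib[symmetric]
      by (simp only: pochhammer_rec[of c] fact_Suc of_nat_mult of_nat_fact)
    also have "\<dots> = pochhammer (- of_nat n) j / (pochhammer (c + 1) j * fact j)"
      using nz(1) by (simp del: of_nat_Suc)
    finally show ?thesis by (simp add: Suc coeff_hyp_poly_1F1)
  qed (simp add: coeff_hyp_poly_1F1)
qed

text \<open>The contiguous relation \<open>(c - a) F(a; c+1) = - a F(a+1; c+1) + c F(a; c)\<close>
  with \<open>a = - of_nat (Suc n)\<close>. Over a common denominator the right side gives
  \<open>(Suc n - k) + (c + k)\<close>, in which \<open>k\<close> cancels.\<close>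

lemma hyp_poly_1F1_lower_denominator:
  assumes "c \<notin> \<int>\<^sub>\<le>\<^sub>0"
  shows "smult (of_nat (Suc n) + c) (hyp_poly (Suc n) [] [c + 1])
    = smult (of_nat (Suc n)) (hyp_poly n [] [c + 1]) + smult c (hyp_poly (Suc n) [] [c])"
proof (rule poly_eqI)
  fix k
  have "pochhammer c (Suc k) \<noteq> 0"
    using assms pochhammer_eq_0_imp_nonpos_Int by blast
  then have nz: "c \<noteq> 0" "pochhammer c k \<noteq> 0" "pochhammer (c + 1) k \<noteq> 0"
    by (metis mult_eq_0_iff pochhammer_rec, metis mult_eq_0_iff pochhammer_rec', metis mult_eq_0_iff pochhammer_rec)
  show "coeff (smult (of_nat (Suc n) + c) (hyp_poly (Suc n) [] [c + 1])) k
      = coeff (smult (of_nat (Suc n)) (hyp_poly n [] [c + 1]) + smult c (hyp_poly (Suc n) [] [c])) k"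
  proof -
    let ?p = "pochhammer (- of_nat (Suc n) :: complex) k"
    have 1: "of_nat (Suc n) * pochhammer (- of_nat n) k = (of_nat (Suc n) - of_nat k) * ?p"
      using pochhammer_shift[of "- of_nat (Suc n) :: complex" k, unfolded neg_Suc_plus_1]
      by (simp add: algebra_simps)
    have 2: "c * (?p / (pochhammer c k * fact k)) = (c + of_nat k) * ?p / (pochhammer (c + 1) k * fact k)"
      using nz pochhammer_shift[of c k] by (simp add: divide_simps mult_ac)
    show ?thesis
      unfolding coeff_smult coeff_add coeff_hyp_poly_1F1 2 unfolding times_divide_eq_right 1
      unfolding add_divide_distrib[symmetric] distrib_right[symmetric]
      by (simp add: ac_simps)
  qed
qed

section \<open>Jacobi and Laguerre polynomials\<close>

lemma pochhammer_neg_of_nat: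
  assumes "k \<le> n"
  shows "pochhammer (- of_nat n) k * fact (n - k) = (- 1) ^ k * (fact n :: 'a :: field_char_0)"
proof -
  have "(fact n :: 'a) = pochhammer 1 (n - k) * pochhammer (1 + of_nat (n - k)) k"
    using assms pochhammer_product'[of "1 :: 'a" "n - k" k] by (simp add: pochhammer_fact)
  then show ?thesis
    using assms by (simp add: pochhammer_minus pochhammer_fact[of "n - k"] of_nat_diff algebra_simps)
qed

text \<open>\<open>pochhammer (a + 1) n\<close> splits at \<open>k\<close>, and its tail is the
  numerator of the binomial coefficient on the left.\<close>

lemma gbinomial_diff_pochhammer:
  fixes a :: "'a :: field_char_0"
  assumes "k \<le> n"
  shows "(- 1) ^ k * ((of_nat n + a) gchoose (n - k)) * pochhammer (a + 1) k
    = ((of_nat n + a) gchoose n) * pochhammer (- of_nat n) k"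
proof -
  have 1: "(of_nat n + a) gchoose (n - k) = pochhammer (a + 1 + of_nat k) (n - k) / fact (n - k)"
    using assms by (simp add: gbinomial_pochhammer' of_nat_diff algebra_simps)
  have 2: "(of_nat n + a) gchoose n = pochhammer (a + 1) k * pochhammer (a + 1 + of_nat k) (n - k) / fact n"
    using assms by (simp add: gbinomial_pochhammer' pochhammer_product)
  have 3: "pochhammer (- of_nat n) k = (- 1) ^ k * fact n / (fact (n - k) :: 'a)"
    using pochhammer_neg_of_nat[OF assms, where 'a = 'a] by (simp add: field_simps)
  show ?thesis unfolding 1 2 3 by simp
qed

text \<open>This number normalises the hypergeometric forms of the Laguerre and Jacobi polynomials;
  being nonzero, it cancels in the logarithmic derivative.\<close>

lemma gbinomial_top_nonzero:
  fixes a :: complex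
  assumes "a + 1 \<notin> \<int>\<^sub>\<le>\<^sub>0"
  shows "(of_nat n + a) gchoose n \<noteq> 0"
  using assms pochhammer_eq_0_imp_nonpos_Int[of "a + 1" n] by (auto simp: gbinomial_pochhammer')

lemma gbinomial_diff_eq:
  fixes a :: complex
  assumes "a + 1 \<notin> \<int>\<^sub>\<le>\<^sub>0" "k \<le> n"
  shows "(of_nat n + a) gchoose (n - k)
    = (- 1) ^ k * ((of_nat n + a) gchoose n) * pochhammer (- of_nat n) k / pochhammer (a + 1) k"
proof -
  have "pochhammer (a + 1) k \<noteq> 0"
    using assms pochhammer_eq_0_imp_nonpos_Int by blast
  moreover have "(- 1) ^ k * ((- 1) ^ k * ((of_nat n + a) gchoose (n - k)) * pochhammer (a + 1) k)
      = ((of_nat n + a) gchoose (n - k)) * pochhammer (a + 1) k"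
    by (simp add: mult.assoc[symmetric] power_add[symmetric] flip: power_mult_distrib)
  ultimately show ?thesis
    unfolding gbinomial_diff_pochhammer[OF assms(2)] by (simp add: field_simps)
qed

lemma laguerre_eq_hyp_poly:
  assumes "a + 1 \<notin> \<int>\<^sub>\<le>\<^sub>0"
  shows "laguerre a n = smult ((of_nat n + a) gchoose n) (hyp_poly n [] [a + 1])"
proof (rule poly_eqI)
  fix k
  have "coeff (laguerre a n) k
      = (if k \<le> n then (- 1) ^ k * ((of_nat n + a) gchoose (n - k)) / fact k else 0)"
    unfolding laguerre_def coeff_sum coeff_monom by (subst sum.delta) auto
  also have "\<dots> = ((of_nat n + a) gchoose n) * (pochhammer (- of_nat n) k / (pochhammer (a + 1) k * fact k))"
  proof (cases "k \<le> n")
    case True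
    then show ?thesis
      by (simp add: gbinomial_diff_eq[OF assms True] mult.assoc[symmetric] flip: power_mult_distrib)
  next
    case False
    then show ?thesis by (simp add: pochhammer_of_nat_eq_0_lemma)
  qed
  finally show "coeff (laguerre a n) k = coeff (smult ((of_nat n + a) gchoose n) (hyp_poly n [] [a + 1])) k"
    by (simp add: coeff_hyp_poly_1F1)
qed

text \<open>Trinomial revision extracts \<open>(of_nat n + a) gchoose (n - k)\<close>, which does
  not depend on \<open>s\<close>; the rest is a Vandermonde convolution. The sum is the coefficient
  of \<open>((x - 1) / 2) ^ k\<close> in the Jacobi polynomial.\<close>

lemma jacobi_coeff_sum:
  fixes a b :: "'a :: field_char_0"
  assumes "k \<le> n"
  shows "(\<Sum>s\<le>k. ((of_nat n + a) gchoose (n - s)) * ((of_nat n + b) gchoose s) * of_nat ((n - s) choose (k - s)))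
    = ((of_nat n + a) gchoose (n - k)) * ((of_nat n + a + b + of_nat k) gchoose k)"
proof -
  have "((of_nat n + a) gchoose (n - s)) * ((of_nat n + b) gchoose s) * of_nat ((n - s) choose (k - s))
      = ((of_nat n + a) gchoose (n - k)) * (((of_nat n + b) gchoose s) * ((a + of_nat k) gchoose (k - s)))"
    if "s \<le> k" for s
  proof -
    have "(n - s) choose (k - s) = (n - s) choose (n - k)"
      using binomial_symmetric[of "k - s" "n - s"] that assms by simp
    moreover have "((of_nat n + a) gchoose (n - s)) * (of_nat (n - s) gchoose (n - k))
        = ((of_nat n + a) gchoose (n - k)) * ((of_nat n + a - of_nat (n - k)) gchoose (n - s - (n - k)))"
      using that assms by (intro gbinomial_trinomial_revision) auto
    moreover have "of_nat n + a - of_nat (n - k) = a + of_nat k" "n - s - (n - k) = k - s"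
      using that assms by (auto simp: of_nat_diff)
    ultimately show ?thesis by (simp add: binomial_gbinomial mult_ac)
  qed
  then have "(\<Sum>s\<le>k. ((of_nat n + a) gchoose (n - s)) * ((of_nat n + b) gchoose s) * of_nat ((n - s) choose (k - s)))
      = ((of_nat n + a) gchoose (n - k)) * (\<Sum>s\<in>{0..k}. ((of_nat n + b) gchoose s) * ((a + of_nat k) gchoose (k - s)))"
    by (simp only: sum_distrib_left atLeast0AtMost) (intro sum.cong, auto)
  also have "(\<Sum>s\<in>{0..k}. ((of_nat n + b) gchoose s) * ((a + of_nat k) gchoose (k - s)))
      = ((of_nat n + b) + (a + of_nat k)) gchoose k"
    by (rule gbinomial_Vandermonde)
  finally show ?thesis by (simp add: algebra_simps)
qed

text \<open>Expansion about 1: with \<open>y = (x - 1) / 2\<close> the other factor is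
  \<open>y + 1\<close>, whose powers are expanded binomially; terms are then collected by the total
  exponent \<open>k = s + j\<close>.\<close>

lemma poly_jacobi:
  fixes a b x :: "'a :: field_char_0"
  shows "poly (jacobi a b n) x = (\<Sum>k\<le>n. ((of_nat n + a) gchoose (n - k))
    * ((of_nat n + a + b + of_nat k) gchoose k) * ((x - 1) / 2) ^ k)"
proof -
  define y where "y = (x - 1) / 2"
  let ?A = "\<lambda>s. ((of_nat n + a) gchoose (n - s)) * ((of_nat n + b) gchoose s)"
  let ?f = "\<lambda>s j. ?A s * of_nat ((n - s) choose j) * y ^ (s + j)"
  have "x = 1 + 2 * y" by (simp add: y_def diff_divide_distrib)
  then have "poly (jacobi a b n) x = (\<Sum>s\<le>n. ?A s * (y ^ s * (y + 1) ^ (n - s)))"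
    by (simp add: jacobi_def poly_sum algebra_simps add_divide_distrib)
  also have "\<dots> = (\<Sum>s\<le>n. \<Sum>j\<le>n - s. ?f s j)"
    by (simp add: binomial_ring sum_distrib_left power_add mult_ac)
  also have "\<dots> = (\<Sum>(s, j)\<in>{(s, j). s + j \<le> n}. ?f s j)"
    by (subst sum.Sigma) (auto intro!: sum.cong)
  also have "\<dots> = (\<Sum>k\<le>n. \<Sum>s\<le>k. ?f s (k - s))"
    by (rule sum.triangle_reindex_eq)
  also have "\<dots> = (\<Sum>k\<le>n. (\<Sum>s\<le>k. ?A s * of_nat ((n - s) choose (k - s))) * y ^ k)"
    by (simp add: sum_distrib_right)
  also have "\<dots> = (\<Sum>k\<le>n. ((of_nat n + a) gchoose (n - k))
    * ((of_nat n + a + b + of_nat k) gchoose k) * y ^ k)"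
    by (intro sum.cong refl) (simp add: jacobi_coeff_sum)
  finally show ?thesis by (simp only: y_def)
qed

lemma poly_hyp_poly: "poly (hyp_poly n as bs) x = (\<Sum>k\<le>n. coeff (hyp_poly n as bs) k * x ^ k)"
  unfolding coeff_hyp_poly by (simp add: hyp_poly_def poly_sum poly_monom del: fps_hypergeo_nth)

text \<open>The inner polynomial is \<open>(1 - x) / 2\<close>, which at \<open>x = 1 / z\<close> is
  the argument \<open>(z - 1) / (2 * z)\<close> of the theorem. The sign from
  \<open>gbinomial_diff_eq\<close> is absorbed by the passage from \<open>(x - 1) / 2\<close> to
  \<open>(1 - x) / 2\<close>.\<close>

lemma jacobi_eq_hyp_poly:
  assumes "a + 1 \<notin> \<int>\<^sub>\<le>\<^sub>0"
  shows "jacobi a b n = smult ((of_nat n + a) gchoose n)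
    (pcompose (hyp_poly n [of_nat n + a + b + 1] [a + 1]) [:1 / 2, - 1 / 2:])"
proof (rule poly_ext)
  fix x :: complex
  define y where "y = (x - 1) / 2"
  \<comment> \<open>Written as \<open>- 1 * y\<close> so that \<open>power_mult_distrib\<close> can
    split off the sign.\<close>
  have y: "1 / 2 + x * (- 1 / 2) = - 1 * y" by (simp add: y_def field_simps)
  have "((of_nat n + a) gchoose (n - k)) * ((of_nat n + a + b + of_nat k) gchoose k) * y ^ k
      = ((of_nat n + a) gchoose n) * (coeff (hyp_poly n [of_nat n + a + b + 1] [a + 1]) k * (- 1 * y) ^ k)"
    if "k \<le> n" for k
    unfolding gbinomial_diff_eq[OF assms that] coeff_hyp_poly_2F1 power_mult_distrib
    by (simp add: gbinomial_pochhammer' add_ac mult_ac)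
  then show "poly (jacobi a b n) x = poly (smult ((of_nat n + a) gchoose n)
    (pcompose (hyp_poly n [of_nat n + a + b + 1] [a + 1]) [:1 / 2, - 1 / 2:])) x"
    unfolding poly_jacobi y_def[symmetric] poly_smult poly_pcompose poly_pCons poly_0 mult_zero_right add_0_right y
    by (simp add: poly_hyp_poly sum_distrib_left)
qed

section \<open>Generating functions for the Laguerre and Jacobi zeros\<close>

lemma of_real_not_nonpos_Int:
  assumes "x > 0"
  shows "(of_real x :: complex) \<notin> \<int>\<^sub>\<le>\<^sub>0"
  using assms by (auto simp: nonpos_Ints_def complex_eq_iff)

lemma moment_gf_laguerre:
  fixes \<alpha> :: real
  assumes "N \<ge> 1" "z \<noteq> 0" "\<alpha> > -1" "cmod z * max_zero_norm (laguerre (of_real \<alpha>) N) < 1"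
  shows "moment_gf (laguerre (of_real \<alpha>) N) z =
    1 - hyp1F1 (- of_nat N + 1) (of_real \<alpha> + 1) (1 / z) / hyp1F1 (- of_nat N) (of_real \<alpha> + 1) (1 / z)"
proof -
  obtain M where M: "N = Suc M" using assms(1) by (cases N) auto
  define c where "c = complex_of_real \<alpha> + 1"
  define C where "C = (of_nat N + complex_of_real \<alpha>) gchoose N"
  let ?K = "\<lambda>n. poly (hyp_poly n [] [c]) (1 / z)"
  have c: "c \<notin> \<int>\<^sub>\<le>\<^sub>0"
    using of_real_not_nonpos_Int[of "\<alpha> + 1"] assms(3) by (simp add: c_def)
  have C: "C \<noteq> 0" using c unfolding C_def c_def by (rule gbinomial_top_nonzero)
  have L: "laguerre (of_real \<alpha>) N = smult C (hyp_poly N [] [c])"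
    using laguerre_eq_hyp_poly c unfolding C_def c_def by blast
  have deg: "degree (laguerre (complex_of_real \<alpha>) N) = N"
    unfolding L using C by (simp add: degree_hyp_poly_1F1[OF c])
  have nz: "?K N \<noteq> 0"
    using poly_nonzero_at_inverse[OF deg assms(1,4,2)] by (simp add: L)
  have "1 / z * poly (pderiv (hyp_poly N [] [c])) (1 / z) = - of_nat N * (?K M - ?K N)"
    using arg_cong[OF X_pderiv_hyp_poly_1F1[of M c], of "\<lambda>p. poly p (1 / z)"] unfolding M
    by (simp del: of_nat_Suc)
  then have "1 / (of_nat N * z) * (poly (pderiv (hyp_poly N [] [c])) (1 / z) / ?K N) = 1 - ?K M / ?K N"
    using assms(1,2) nz by (simp add: field_simps)
  then have "moment_gf (laguerre (of_real \<alpha>) N) z = 1 - ?K M / ?K N"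
    unfolding moment_gf_log_deriv[OF deg assms(1,4,2)] unfolding L using C by (simp add: pderiv_smult)
  also have "?K M = hyp1F1 (- of_nat N + 1) c (1 / z)"
    unfolding M neg_Suc_plus_1 hyp1F1_eq_poly ..
  finally show ?thesis by (simp only: hyp1F1_eq_poly c_def)
qed

lemma moment_gf_jacobi:
  fixes \<alpha> \<beta> :: real
  assumes "N \<ge> 1" "z \<noteq> 0" "\<alpha> > -1" "\<beta> > -1"
    "cmod z * max_zero_norm (jacobi (of_real \<alpha>) (of_real \<beta>) N) < 1"
  shows "moment_gf (jacobi (of_real \<alpha>) (of_real \<beta>) N) z =
    (of_nat N + of_real \<alpha> + of_real \<beta> + 1) / (2 * (of_real \<alpha> + 1)) * (1 / z) *
      (hyp2F1 (- of_nat N + 1) (of_nat N + of_real \<alpha> + of_real \<beta> + 2) (of_real \<alpha> + 2) ((z - 1) / (2 * z)) /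
       hyp2F1 (- of_nat N) (of_nat N + of_real \<alpha> + of_real \<beta> + 1) (of_real \<alpha> + 1) ((z - 1) / (2 * z)))"
proof -
  obtain M where M: "N = Suc M" using assms(1) by (cases N) auto
  define c where "c = complex_of_real \<alpha> + 1"
  define b where "b = of_nat N + complex_of_real \<alpha> + of_real \<beta> + 1"
  define C where "C = (of_nat N + complex_of_real \<alpha>) gchoose N"
  define u where "u = (z - 1) / (2 * z)"
  let ?G = "hyp_poly N [b] [c]"
  let ?J = "jacobi (complex_of_real \<alpha>) (of_real \<beta>) N"
  have c: "c \<notin> \<int>\<^sub>\<le>\<^sub>0"
    using of_real_not_nonpos_Int[of "\<alpha> + 1"] assms(3) by (simp add: c_def)
  \<comment> \<open>\<open>N + \<alpha> + \<beta> + 1\<close> is positive since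
    \<open>N \<ge> 1\<close>; this keeps the top coefficient nonzero, so the degree is exactly
    \<open>N\<close>.\<close>
  have b: "b \<notin> \<int>\<^sub>\<le>\<^sub>0"
    using of_real_not_nonpos_Int[of "real N + \<alpha> + \<beta> + 1"] assms(1,3,4) by (simp add: b_def)
  have C: "C \<noteq> 0" using c unfolding C_def c_def by (rule gbinomial_top_nonzero)
  have J: "?J = smult C (pcompose ?G [:1 / 2, - 1 / 2:])"
    using jacobi_eq_hyp_poly c unfolding C_def c_def b_def by blast
  have deg: "degree ?J = N"
    unfolding J using C by (simp add: degree_pcompose degree_hyp_poly_2F1[OF c b])
  have u: "poly [:1 / 2, - 1 / 2:] (1 / z) = u"
    using assms(2) by (simp add: u_def field_simps)
  have "poly ?J (1 / z) = C * poly ?G u"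
    unfolding J poly_smult poly_pcompose u ..
  \<comment> \<open>The inner derivative \<open>- 1 / 2\<close> and the factor
    \<open>- of_nat N * b / c\<close> from the series combine to \<open>b / (2 * c)\<close> once
    \<open>of_nat N\<close> is cancelled.\<close>
  moreover have "poly (pderiv ?J) (1 / z) = C * (poly (pderiv ?G) u * (- 1 / 2))"
    unfolding J pderiv_smult pderiv_pcompose poly_smult poly_mult poly_pcompose u
    by (simp add: pderiv_pCons)
  moreover have "poly (pderiv ?G) u = - of_nat N * b / c * poly (hyp_poly M [b + 1] [c + 1]) u"
    unfolding M pderiv_hyp_poly_2F1[OF c] poly_smult ..
  ultimately have "moment_gf ?J z = 1 / (of_nat N * z) *
      (C * (- of_nat N * b / c * poly (hyp_poly M [b + 1] [c + 1]) u * (- 1 / 2)) / (C * poly ?G u))"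
    using moment_gf_log_deriv[OF deg assms(1,5,2)] by (simp only:)
  also have "\<dots> = b / (2 * c) * (1 / z) * (poly (hyp_poly M [b + 1] [c + 1]) u / poly ?G u)"
    using C assms(1) by simp
  also have "poly (hyp_poly M [b + 1] [c + 1]) u = hyp2F1 (- of_nat N + 1) (b + 1) (c + 1) u"
    unfolding M neg_Suc_plus_1 hyp2F1_eq_poly ..
  finally show ?thesis
    by (simp add: hyp2F1_eq_poly[symmetric] b_def c_def u_def add.assoc)
qed

section \<open>Chebyshev polynomials\<close>

text \<open>Here \<open>q\<close> and \<open>p = 1 / q\<close> are the two preimages of \<open>(q + p) / 2\<close> under the Joukowski map.\<close>

lemma chebyshev_T_Joukowski:
  fixes q p :: "'a :: field_char_0"
  assumes "q * p = 1"
  shows "2 * poly (chebyshev_T n) ((q + p) / 2) = q ^ n + p ^ n"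
    and "poly (pderiv (chebyshev_T n)) ((q + p) / 2) * (q - p) = of_nat n * (q ^ n - p ^ n)"
proof -
  have T: "2 * poly (chebyshev_T n) ((q + p) / 2) = q ^ n + p ^ n" for n
  proof (induction n rule: chebyshev_T.induct)
    case (3 n)
    have "2 * poly (chebyshev_T (Suc (Suc n))) ((q + p) / 2)
        = (q + p) * (2 * poly (chebyshev_T (Suc n)) ((q + p) / 2)) - 2 * poly (chebyshev_T n) ((q + p) / 2)"
      by (simp add: algebra_simps)
    also have "\<dots> = (q + p) * (q * q ^ n + p * p ^ n) - (q ^ n + p ^ n)"
      unfolding 3 by simp
    \<comment> \<open>What is left over from the recurrence is a multiple of
      \<open>q * p - 1\<close>, hence zero.\<close>
    also have "\<dots> = q * (q * q ^ n) + p * (p * p ^ n) + (q * p - 1) * (q ^ n + p ^ n)"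
      by (simp add: algebra_simps)
    also have "\<dots> = q * (q * q ^ n) + p * (p * p ^ n)"
      using assms by simp
    finally show ?case by simp
  qed auto
  then show "2 * poly (chebyshev_T n) ((q + p) / 2) = q ^ n + p ^ n" .
  show "poly (pderiv (chebyshev_T n)) ((q + p) / 2) * (q - p) = of_nat n * (q ^ n - p ^ n)"
  proof (induction n rule: chebyshev_T.induct)
    case (3 n)
    let ?D = "\<lambda>n. poly (pderiv (chebyshev_T n)) ((q + p) / 2) * (q - p)"
    have "?D (Suc (Suc n)) = (2 * poly (chebyshev_T (Suc n)) ((q + p) / 2)) * (q - p)
        + (q + p) * ?D (Suc n) - ?D n"
      unfolding chebyshev_T.simps pderiv_diff pderiv_mult
      by (simp add: pderiv_pCons left_diff_distrib distrib_right)
    also have "\<dots> = (q * q ^ n + p * p ^ n) * (q - p)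
        + (q + p) * ((of_nat n + 1) * (q * q ^ n - p * p ^ n)) - of_nat n * (q ^ n - p ^ n)"
      unfolding 3 T by (simp add: add.commute)
    also have "\<dots> = (of_nat n + 2) * (q * (q * q ^ n) - p * (p * p ^ n))
        + (q * p - 1) * (of_nat n * (q ^ n - p ^ n))"
      by (simp add: algebra_simps)
    also have "\<dots> = (of_nat n + 2) * (q * (q * q ^ n) - p * (p * p ^ n))"
      using assms by simp
    finally show ?case by (simp add: algebra_simps)
  qed (auto simp: pderiv_pCons)
qed

text \<open>Differentiating \<open>(q^(n+1) - p^(n+1)) / (q - p)\<close> in
  \<open>w = (q + p) / 2\<close> explains the cube: the quotient rule contributes
  \<open>(q - p)^2\<close>, and \<open>dw/dq = (q - p) / (2 q)\<close> one more factor. The proof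
  itself is algebraic, by the recurrence.\<close>

lemma chebyshev_U_Joukowski:
  fixes q p :: "'a :: field_char_0"
  assumes "q * p = 1"
  shows "poly (chebyshev_U n) ((q + p) / 2) * (q - p) = q ^ Suc n - p ^ Suc n"
    and "poly (pderiv (chebyshev_U n)) ((q + p) / 2) * (q - p) ^ 3
      = 2 * (of_nat (Suc n) * (q ^ Suc n + p ^ Suc n) * (q - p) - (q + p) * (q ^ Suc n - p ^ Suc n))"
proof -
  have U: "poly (chebyshev_U n) ((q + p) / 2) * (q - p) = q * q ^ n - p * p ^ n" for n
  proof (induction n rule: chebyshev_U.induct)
    case (3 n)
    let ?V = "\<lambda>n. poly (chebyshev_U n) ((q + p) / 2) * (q - p)"
    have "?V (Suc (Suc n)) = (q + p) * ?V (Suc n) - ?V n"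
      by (simp add: left_diff_distrib)
    also have "\<dots> = (q + p) * (q * (q * q ^ n) - p * (p * p ^ n)) - (q * q ^ n - p * p ^ n)"
      unfolding 3 by simp
    also have "\<dots> = q * (q * (q * q ^ n)) - p * (p * (p * p ^ n)) + (q * p - 1) * (q * q ^ n - p * p ^ n)"
      by (simp add: algebra_simps)
    also have "\<dots> = q * (q * (q * q ^ n)) - p * (p * (p * p ^ n))"
      using assms by simp
    finally show ?case by simp
  next
    case 2
    have *: "poly (chebyshev_U (Suc 0)) ((q + p) / 2) = q + p" by (simp add: field_simps)
    show ?case unfolding * by (simp add: algebra_simps)
  qed simp
  then show "poly (chebyshev_U n) ((q + p) / 2) * (q - p) = q ^ Suc n - p ^ Suc n"
    by simp
  \<comment> \<open>With \<open>x\<close>, \<open>y\<close>, \<open>k\<close> standing for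
    \<open>q ^ n\<close>, \<open>p ^ n\<close>, \<open>of_nat n\<close>, the induction step is a
    polynomial identity modulo \<open>q * p = 1\<close>.\<close>
  have step: "2 * (q * (q * x) - p * (p * y)) * (q - p) ^ 2
      + (q + p) * (2 * ((k + 2) * (q * (q * x) + p * (p * y)) * (q - p)
         - (q + p) * (q * (q * x) - p * (p * y))))
      - 2 * ((k + 1) * (q * x + p * y) * (q - p) - (q + p) * (q * x - p * y))
    = 2 * ((k + 3) * (q * (q * (q * x)) + p * (p * (p * y))) * (q - p)
      - (q + p) * (q * (q * (q * x)) - p * (p * (p * y))))" for x y k
    using assms by algebra
  have "poly (pderiv (chebyshev_U n)) ((q + p) / 2) * (q - p) ^ 3
      = 2 * ((of_nat n + 1) * (q * q ^ n + p * p ^ n) * (q - p) - (q + p) * (q * q ^ n - p * p ^ n))"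
  proof (induction n rule: chebyshev_U.induct)
    case 1
    then show ?case by (simp add: algebra_simps)
  next
    case 2
    have "2 * (q - p) ^ 3 = 2 * (2 * (q * q + p * p) * (q - p) - (q + p) * (q * q - p * p))"
      by (simp add: algebra_simps power3_eq_cube)
    then show ?case by (simp add: pderiv_pCons)
  next
    case (3 n)
    let ?D = "\<lambda>n. poly (pderiv (chebyshev_U n)) ((q + p) / 2) * (q - p) ^ 3"
    have "?D (Suc (Suc n)) = 2 * (poly (chebyshev_U (Suc n)) ((q + p) / 2) * (q - p)) * (q - p) ^ 2
        + (q + p) * ?D (Suc n) - ?D n"
    proof -
      have "poly (pderiv (chebyshev_U (Suc (Suc n)))) ((q + p) / 2)
          = 2 * poly (chebyshev_U (Suc n)) ((q + p) / 2)
            + (q + p) * poly (pderiv (chebyshev_U (Suc n))) ((q + p) / 2)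
            - poly (pderiv (chebyshev_U n)) ((q + p) / 2)"
        unfolding chebyshev_U.simps pderiv_diff pderiv_mult by (simp add: pderiv_pCons)
      moreover have "(2 * x + y * x' - x'') * d ^ 3 = 2 * (x * d) * d ^ 2 + y * (x' * d ^ 3) - x'' * d ^ 3"
        for x x' x'' y d :: 'a
        by (simp add: algebra_simps power2_eq_square power3_eq_cube)
      ultimately show ?thesis by (simp only:)
    qed
    also have "\<dots> = 2 * (q * (q * q ^ n) - p * (p * p ^ n)) * (q - p) ^ 2
        + (q + p) * (2 * ((of_nat n + 2) * (q * (q * q ^ n) + p * (p * p ^ n)) * (q - p)
           - (q + p) * (q * (q * q ^ n) - p * (p * p ^ n))))
        - 2 * ((of_nat n + 1) * (q * q ^ n + p * p ^ n) * (q - p) - (q + p) * (q * q ^ n - p * p ^ n))"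
      unfolding 3 U by (simp add: add_ac)
    also have "\<dots> = 2 * ((of_nat n + 3) * (q * (q * (q * q ^ n)) + p * (p * (p * p ^ n))) * (q - p)
        - (q + p) * (q * (q * (q * q ^ n)) - p * (p * (p * p ^ n))))"
      by (rule step)
    finally show ?case by (simp add: add_ac)
  qed
  then show "poly (pderiv (chebyshev_U n)) ((q + p) / 2) * (q - p) ^ 3
      = 2 * (of_nat (Suc n) * (q ^ Suc n + p ^ Suc n) * (q - p) - (q + p) * (q ^ Suc n - p ^ Suc n))"
    by (simp add: add_ac)
qed

text \<open>The subtracted term has lower degree than the product with \<open>[:0, d:]\<close>, so
  leading terms cannot cancel. Two consecutive degrees are carried because the recurrence looks back
  two steps.\<close>

lemma degree_three_term_recurrence:
  fixes P :: "nat \<Rightarrow> 'a :: idom poly" and c :: "nat \<Rightarrow> 'a"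
  assumes "d \<noteq> 0" "P 0 \<noteq> 0" "degree (P 0) = 0" "degree (P 1) = 1"
    and rec: "\<And>n. P (Suc (Suc n)) = [:0, d:] * P (Suc n) - smult (c n) (P n)"
  shows "degree (P n) = n"
proof -
  have "degree (P n) = n \<and> degree (P (Suc n)) = Suc n"
  proof (induction n)
    case (Suc n)
    then have "P (Suc n) \<noteq> 0" by auto
    then have "degree ([:0, d:] * P (Suc n)) = Suc (Suc n)"
      using Suc assms(1) by (subst degree_mult_eq) auto
    moreover have "degree (smult (c n) (P n)) < Suc (Suc n)"
      using Suc degree_smult_le[of "c n" "P n"] by linarith
    ultimately have "degree (P (Suc (Suc n))) = Suc (Suc n)"
      unfolding rec diff_conv_add_uminus by (subst degree_add_eq_left) auto
    with Suc show ?case by simp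
  qed (use assms in auto)
  then show ?thesis ..
qed

lemma degree_chebyshev_T: "degree (chebyshev_T n :: complex poly) = n"
  by (rule degree_three_term_recurrence[where d = 2 and c = "\<lambda>_. 1"]) auto

lemma degree_chebyshev_U: "degree (chebyshev_U n :: complex poly) = n"
  by (rule degree_three_term_recurrence[where d = 2 and c = "\<lambda>_. 1"]) auto

text \<open>The solutions of \<open>(q + 1 / q) / 2 = 1 / z\<close> are \<open>(1 + s) / z\<close>
  and \<open>(1 - s) / z\<close>; \<open>(1 - s) * (1 + s) = z\<^sup>2\<close> rewrites the first as
  \<open>z / (1 - s)\<close>, the argument of \<open>ln\<close> in the theorem.\<close>

lemma inverse_Joukowski:
  fixes z :: complex
  assumes "z \<noteq> 0" "cmod z < 1"
  defines "s \<equiv> csqrt (1 - z\<^sup>2)"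
  defines "q \<equiv> z / (1 - s)" and "p \<equiv> (1 - s) / z"
  shows "s \<noteq> 0" "q * p = 1" "(q + p) / 2 = 1 / z" "q - p = 2 * s / z"
proof -
  have s2: "s\<^sup>2 = 1 - z\<^sup>2" unfolding s_def by (rule power2_csqrt)
  \<comment> \<open>Excludes \<open>z = 1\<close> and \<open>z = - 1\<close>, where
    \<open>s = 0\<close> and \<open>q\<close> and \<open>p\<close> coincide.\<close>
  have "cmod (z\<^sup>2) < 1"
    using assms(2) by (simp add: norm_power power_less_one_iff)
  then have "1 - z\<^sup>2 \<noteq> 0" by auto
  then show "s \<noteq> 0" using s2 by auto
  have "(1 - s) * (1 + s) = z * z"
    using s2 by (simp add: power2_eq_square algebra_simps)
  moreover from this have s1: "1 - s \<noteq> 0" using assms(1) by auto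
  ultimately have q: "q = (1 + s) / z"
    using assms(1) by (simp add: q_def divide_simps mult_ac)
  show "q * p = 1" using s1 assms(1) by (simp add: q_def p_def)
  show "(q + p) / 2 = 1 / z" "q - p = 2 * s / z"
    unfolding q p_def using assms(1) by (simp_all add: divide_simps)
qed

text \<open>Integer multiples of \<open>ln\<close> become powers under \<open>exp\<close>, which is
  why the branch of \<open>ln\<close> leaves no trace.\<close>

lemma exp_of_nat_ln:
  fixes q p :: complex
  assumes "q * p = 1"
  shows "exp (of_nat n * ln q) = q ^ n" "exp (- (of_nat n * ln q)) = p ^ n"
proof -
  have q: "q \<noteq> 0" using assms by auto
  then show 1: "exp (of_nat n * ln q) = q ^ n" by (simp add: exp_of_nat_mult)
  have "p = inverse q" using assms by (simp add: inverse_unique)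
  then show "exp (- (of_nat n * ln q)) = p ^ n"
    unfolding exp_minus 1 by (simp add: power_inverse)
qed

section \<open>Generating functions for the Chebyshev zeros\<close>

lemma moment_gf_chebyshev_T:
  assumes "N \<ge> 1" "z \<noteq> 0" "cmod z < 1" "cmod z * max_zero_norm (chebyshev_T N) < 1"
  shows "moment_gf (chebyshev_T N) z =
    1 / csqrt (1 - z\<^sup>2) * tanh (of_nat N * ln (z / (1 - csqrt (1 - z\<^sup>2))))"
proof -
  define s where "s = csqrt (1 - z\<^sup>2)"
  define q where "q = z / (1 - s)"
  define p where "p = (1 - s) / z"
  have s: "s \<noteq> 0" and qp: "q * p = 1" and w: "(q + p) / 2 = 1 / z" and d: "q - p = 2 * s / z"
    using inverse_Joukowski[OF assms(2,3)] by (simp_all add: s_def q_def p_def)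
  have T: "poly (chebyshev_T N) (1 / z) = (q ^ N + p ^ N) / 2"
    using chebyshev_T_Joukowski(1)[OF qp, of N] by (simp add: w mult.commute eq_divide_eq)
  have T': "poly (pderiv (chebyshev_T N)) (1 / z) = of_nat N * (q ^ N - p ^ N) * z / (2 * s)"
    using chebyshev_T_Joukowski(2)[OF qp, of N] s assms(2) unfolding w d by (simp add: field_simps)
  have half: "(x / 2) / (y / 2) = x / y" for x y :: complex by simp
  have tanh: "tanh (of_nat N * ln q) = (q ^ N - p ^ N) / (q ^ N + p ^ N)"
    unfolding tanh_def sinh_field_def cosh_field_def exp_of_nat_ln[OF qp] half ..
  show ?thesis
    unfolding moment_gf_log_deriv[OF degree_chebyshev_T assms(1,4,2)] T T' s_def[symmetric] q_def[symmetric] tanh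
    using assms(1,2) s by simp
qed

lemma moment_gf_chebyshev_U:
  assumes "N \<ge> 1" "z \<noteq> 0" "cmod z < 1" "cmod z * max_zero_norm (chebyshev_U N) < 1"
  shows "moment_gf (chebyshev_U N) z =
    1 / csqrt (1 - z\<^sup>2) *
    ((1 + 1 / of_nat N) * coth ((of_nat N + 1) * ln (z / (1 - csqrt (1 - z\<^sup>2))))
     - 1 / of_nat N * (1 / csqrt (1 - z\<^sup>2)))"
proof -
  define s where "s = csqrt (1 - z\<^sup>2)"
  define q where "q = z / (1 - s)"
  define p where "p = (1 - s) / z"
  define A where "A = q ^ Suc N + p ^ Suc N"
  define B where "B = q ^ Suc N - p ^ Suc N"
  have s: "s \<noteq> 0" and qp: "q * p = 1" and w: "(q + p) / 2 = 1 / z" and d: "q - p = 2 * s / z"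
    using inverse_Joukowski[OF assms(2,3)] by (simp_all add: s_def q_def p_def)
  have w': "q + p = 2 / z" using w by (simp add: field_simps)
  have U: "poly (chebyshev_U N) (1 / z) = B * z / (2 * s)"
    using chebyshev_U_Joukowski(1)[OF qp, of N] s assms(2) unfolding w d B_def[symmetric]
    by (simp add: field_simps)
  \<comment> \<open>\<open>B\<close> is twice the hyperbolic sine of
    \<open>(of_nat N + 1) * ln q\<close>, so \<open>coth\<close> is not evaluated at a pole.\<close>
  have B: "B \<noteq> 0"
    using poly_nonzero_at_inverse[OF degree_chebyshev_U assms(1,4,2)] U by auto
  have U': "poly (pderiv (chebyshev_U N)) (1 / z)
      = 2 * ((of_nat N + 1) * A * (2 * s / z) - 2 / z * B) / (2 * s / z) ^ 3"
    using chebyshev_U_Joukowski(2)[OF qp, of N] s assms(2)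
    unfolding w unfolding w' d A_def[symmetric] B_def[symmetric]
    by (simp add: eq_divide_eq add.commute)
  have "coth (of_nat (Suc N) * ln q) = (A / 2) / (B / 2)"
    unfolding coth_def sinh_field_def cosh_field_def exp_of_nat_ln[OF qp] A_def B_def ..
  then have coth: "coth ((of_nat N + 1) * ln q) = A / B" using B by (simp add: add.commute)
  \<comment> \<open>The quotient is \<open>((N + 1) * s * A / B - 1) / (N * s\<^sup>2)\<close>; its
    two terms are the \<open>coth\<close> term and the correction.\<close>
  show ?thesis
    unfolding moment_gf_log_deriv[OF degree_chebyshev_U assms(1,4,2)] U U' s_def[symmetric] q_def[symmetric] coth
    using assms(1,2) s B by (simp add: field_simps power3_eq_cube)
qed

section \<open>Hermite polynomials\<close>

lemma degree_hermite: "degree (hermite n :: complex poly) = n"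
  by (rule degree_three_term_recurrence[where d = 2 and c = "\<lambda>n. 2 * of_nat (Suc n)"]) auto

text \<open>Extends the real \<open>pderiv_hermite\<close> to complex coefficients. For
  \<open>n = Suc m\<close>, differentiating the recurrence leaves \<open>2 * x * H_m - H_m'\<close>
  next to \<open>H_(m+1)\<close>, and the two are equal.\<close>

lemma pderiv_hermite_Suc:
  "pderiv (hermite (Suc n)) = smult (2 * of_nat (Suc n)) (hermite n :: 'a :: idom poly)"
proof (induction n rule: less_induct)
  case (less n)
  show ?case
  proof (cases n)
    case (Suc m)
    have 1: "pderiv (hermite (Suc m)) = smult (2 * of_nat (Suc m)) (hermite m :: 'a poly)"
      using less[of m] Suc by simp
    \<comment> \<open>The recurrence with its last term recognised as a derivative by the induction
      hypothesis at \<open>m - 1\<close>; for \<open>m = 0\<close> that derivative is 0.\<close>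
    have 2: "hermite (Suc m) = [:0, 2:] * (hermite m :: 'a poly) - pderiv (hermite m)"
      using less[of "m - 1"] Suc by (cases m) simp_all
    have "pderiv (hermite (Suc n) :: 'a poly)
        = smult 2 (hermite (Suc m)) + [:0, 2:] * smult (2 * of_nat (Suc m)) (hermite m)
          - smult (2 * of_nat (Suc m)) (pderiv (hermite m))"
      unfolding Suc hermite.simps(3) pderiv_diff pderiv_mult pderiv_smult 1 by (simp add: pderiv_pCons)
    also have "\<dots> = smult 2 (hermite (Suc m))
        + smult (2 * of_nat (Suc m)) ([:0, 2:] * hermite m - pderiv (hermite m))"
      by (simp only: mult_smult_right smult_diff_right add_diff_eq)
    also have "\<dots> = smult (2 * of_nat (Suc n)) (hermite n)"
      unfolding 2[symmetric] Suc by (simp only: smult_add_left[symmetric]) (simp add: algebra_simps)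
    finally show ?thesis .
  qed (simp add: pderiv_pCons)
qed

section \<open>Confluent form of the Hermite polynomials\<close>

lemma half_not_nonpos_Int: "(1 / 2 :: complex) \<notin> \<int>\<^sub>\<le>\<^sub>0"
  using of_real_not_nonpos_Int[of "1 / 2"] by simp

lemma three_halves_pochhammer:
  "pochhammer (3 / 2) m = (2 * of_nat m + 1) * pochhammer (1 / 2 :: complex) m"
  using pochhammer_shift[of "1 / 2 :: complex" m] by (simp add: field_simps)

text \<open>Both parities are proved together since the recurrence alternates between them. The even
  step rests on \<open>hyp_poly_1F1_lower_numerator\<close>, the odd step on
  \<open>hyp_poly_1F1_lower_denominator\<close>, both at \<open>c = 1 / 2\<close>.\<close>

lemma poly_hermite_parity:
  "poly (hermite (2 * m)) w
      = (- 4) ^ m * pochhammer (1 / 2) m * poly (hyp_poly m [] [1 / 2]) (w\<^sup>2) \<and>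
   poly (hermite (2 * m + 1)) w
      = 2 * w * (- 4) ^ m * pochhammer (3 / 2) m * poly (hyp_poly m [] [3 / 2]) (w\<^sup>2)"
proof (induction m)
  case 0
  show ?case by (simp add: poly_hyp_poly coeff_hyp_poly_1F1)
next
  case (Suc m)
  let ?E = "\<lambda>m. poly (hyp_poly m [] [1 / 2]) (w\<^sup>2)" and ?O = "\<lambda>m. poly (hyp_poly m [] [3 / 2]) (w\<^sup>2)"
  let ?c = "(- 4) ^ m * pochhammer (1 / 2 :: complex) m"
  let ?H = "\<lambda>n. poly (hermite n) w"
  have E: "?E m - ?E (Suc m) = 2 * w\<^sup>2 * ?O m"
    using arg_cong[OF hyp_poly_1F1_lower_numerator[OF half_not_nonpos_Int, of m], of "\<lambda>p. poly p (w\<^sup>2)"]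
    by (simp add: field_simps)
  have "2 * ((2 * of_nat m + 3) * ?O (Suc m)) = 2 * ((2 * of_nat m + 2) * ?O m + ?E (Suc m))"
    using arg_cong[OF hyp_poly_1F1_lower_denominator[OF half_not_nonpos_Int, of m], of "\<lambda>p. poly p (w\<^sup>2)"]
    by (simp add: field_simps)
  then have O: "(2 * of_nat m + 3) * ?O (Suc m) = (2 * of_nat m + 2) * ?O m + ?E (Suc m)"
    by (rule mult_left_cancel[THEN iffD1, rotated]) simp
  have even: "?H (Suc (Suc (2 * m))) = - 2 * (2 * of_nat m + 1) * ?c * ?E (Suc m)"
  proof -
    have "?H (Suc (Suc (2 * m))) = 2 * w * ?H (2 * m + 1) - 2 * (2 * of_nat m + 1) * ?H (2 * m)"
      by (simp add: algebra_simps)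
    also have "\<dots> = - 2 * (2 * of_nat m + 1) * ?c * (?E m - 2 * w\<^sup>2 * ?O m)"
      unfolding Suc.IH[THEN conjunct1] Suc.IH[THEN conjunct2] three_halves_pochhammer
      by (simp add: algebra_simps power2_eq_square)
    finally show ?thesis using E by (simp add: algebra_simps)
  qed
  have odd: "?H (Suc (Suc (Suc (2 * m)))) = 2 * w * (- 2 * (2 * of_nat m + 1)) * ?c * ((2 * of_nat m + 3) * ?O (Suc m))"
  proof -
    have "?H (Suc (Suc (Suc (2 * m)))) = 2 * w * ?H (Suc (Suc (2 * m))) - 4 * (of_nat m + 1) * ?H (2 * m + 1)"
      by (simp add: algebra_simps)
    also have "\<dots> = 2 * w * (- 2 * (2 * of_nat m + 1)) * ?c * ((2 * of_nat m + 2) * ?O m + ?E (Suc m))"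
      unfolding even Suc.IH[THEN conjunct2] three_halves_pochhammer
      by (simp add: algebra_simps)
    finally show ?thesis unfolding O .
  qed
  have c: "(- 4) ^ Suc m * pochhammer (1 / 2 :: complex) (Suc m) = - 2 * (2 * of_nat m + 1) * ?c"
    by (simp add: pochhammer_rec' algebra_simps)
  have idx: "2 * Suc m = Suc (Suc (2 * m))" "2 * Suc m + 1 = Suc (Suc (Suc (2 * m)))" by simp_all
  show ?case
  proof
    show "?H (2 * Suc m) = (- 4) ^ Suc m * pochhammer (1 / 2) (Suc m) * ?E (Suc m)"
      unfolding idx(1) even c ..
    have "2 * w * (- 4) ^ Suc m * pochhammer (3 / 2) (Suc m) * ?O (Suc m)
        = 2 * w * ((- 4) ^ Suc m * pochhammer (1 / 2) (Suc m)) * ((2 * of_nat m + 3) * ?O (Suc m))"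
      unfolding three_halves_pochhammer by (simp add: algebra_simps)
    then show "?H (2 * Suc m + 1) = 2 * w * (- 4) ^ Suc m * pochhammer (3 / 2) (Suc m) * ?O (Suc m)"
      unfolding idx(2) odd c by (simp only: mult.assoc)
  qed
qed

text \<open>The functional equation applied \<open>m\<close> times; it evaluates the reciprocal
  Gamma factor that survives and supplies the Pochhammer constant of
  \<open>poly_hermite_parity\<close>.\<close>

lemma rGamma_half_minus:
  "rGamma (1 / 2 - of_nat m :: complex) = (- 1) ^ m * pochhammer (1 / 2) m * rGamma (1 / 2)"
proof -
  have "rGamma (1 / 2 - of_nat m :: complex)
      = pochhammer (1 / 2 - of_nat m) m * rGamma (1 / 2 - of_nat m + of_nat m)"
    by (rule pochhammer_rGamma)
  moreover have "pochhammer (1 / 2 - of_nat m) m = (- 1) ^ m * pochhammer (1 / 2 :: complex) m"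
    using pochhammer_minus[of "of_nat m - 1 / 2 :: complex" m] by simp
  ultimately show ?thesis by simp
qed

text \<open>Exactly one of \<open>- n / 2\<close> and \<open>(1 - n) / 2\<close> is a non-positive
  integer. The series with that parameter terminates, and the other term carries the vanishing
  \<open>rGamma\<close>.\<close>

lemma hermite_eq_hyp1F1:
  "poly (hermite n) w = 2 ^ n * Gamma (1 / 2) *
    (hyp1F1 (- of_nat n / 2) (1 / 2) (w\<^sup>2) * rGamma ((1 - of_nat n) / 2)
     - 2 * w * hyp1F1 ((1 - of_nat n) / 2) (3 / 2) (w\<^sup>2) * rGamma (- of_nat n / 2))"
proof -
  have G: "Gamma (1 / 2 :: complex) * rGamma (1 / 2) = 1"
    using half_not_nonpos_Int by (simp add: rGamma_inverse_Gamma Gamma_eq_zero_iff)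
  have pow: "(- 4 :: complex) ^ m = 2 ^ (2 * m) * (- 1) ^ m" for m
    by (simp add: power_mult flip: power_mult_distrib)
  show ?thesis
  proof (cases "even n")
    case True
    then obtain m where n: "n = 2 * m" by blast
    have params: "(1 - of_nat n) / 2 = (1 / 2 - of_nat m :: complex)" "- of_nat n / 2 = (- of_nat m :: complex)"
      by (simp_all add: n field_simps)
    have "rGamma (- of_nat m :: complex) = 0"
      by (simp add: rGamma_eq_zero_iff)
    moreover have "poly (hermite n) w = 2 ^ (2 * m) * (Gamma (1 / 2) * rGamma (1 / 2))
        * ((- 1) ^ m * pochhammer (1 / 2) m) * poly (hyp_poly m [] [1 / 2]) (w\<^sup>2)"
      unfolding n poly_hermite_parity[THEN conjunct1] pow G by simp
    ultimately show ?thesis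
      unfolding params rGamma_half_minus hyp1F1_eq_poly by (simp add: n mult_ac)
  next
    case False
    then obtain m where n: "n = 2 * m + 1" by (blast elim: oddE)
    \<comment> \<open>Here \<open>- n / 2\<close> lies \<open>Suc m\<close> below
      \<open>1 / 2\<close>: the extra sign cancels the minus before the second term, and the extra 2
      in \<open>2 ^ n\<close> turns \<open>pochhammer (1 / 2) (Suc m)\<close> into
      \<open>pochhammer (3 / 2) m\<close>.\<close>
    have "(1 - of_nat n) / 2 = (- of_nat m :: complex)" "- of_nat n / 2 = (1 / 2 - of_nat (Suc m) :: complex)"
      by (simp_all add: n field_simps)
    moreover have "rGamma (- of_nat m :: complex) = 0"
      by (simp add: rGamma_eq_zero_iff)
    moreover have "2 * pochhammer (1 / 2 :: complex) (Suc m) = pochhammer (3 / 2) m"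
      by (simp add: pochhammer_rec)
    then have "poly (hermite n) w = 2 ^ n * (Gamma (1 / 2) * rGamma (1 / 2)) * (2 * w)
        * ((- 1) ^ m * pochhammer (1 / 2) (Suc m)) * poly (hyp_poly m [] [3 / 2]) (w\<^sup>2)"
      unfolding n poly_hermite_parity[THEN conjunct2] pow G by (simp add: algebra_simps)
    ultimately show ?thesis
      by (simp add: rGamma_half_minus hyp1F1_eq_poly mult_ac del: of_nat_Suc)
  qed
qed

lemma moment_gf_hermite:
  assumes "N \<ge> 1" "z \<noteq> 0" "cmod z * max_zero_norm (hermite N) < 1"
  shows "moment_gf (hermite N) z =
    1 / z *
    ((hyp1F1 (- (of_nat N - 1) / 2) (1 / 2) (1 / z\<^sup>2) * rGamma ((2 - of_nat N) / 2)
      - 2 / z * hyp1F1 ((2 - of_nat N) / 2) (3 / 2) (1 / z\<^sup>2) * rGamma ((1 - of_nat N) / 2)) /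
     (hyp1F1 (- of_nat N / 2) (1 / 2) (1 / z\<^sup>2) * rGamma ((1 - of_nat N) / 2)
      - 2 / z * hyp1F1 ((1 - of_nat N) / 2) (3 / 2) (1 / z\<^sup>2) * rGamma (- of_nat N / 2)))"
    (is "_ = 1 / z * (?A / ?B)")
proof -
  obtain M where M: "N = Suc M" using assms(1) by (cases N) auto
  have G: "Gamma (1 / 2 :: complex) \<noteq> 0"
    using half_not_nonpos_Int by (simp add: Gamma_eq_zero_iff)
  have w: "(1 / z)\<^sup>2 = 1 / z\<^sup>2" "2 * (1 / z) = 2 / z" by (simp_all add: power_divide)
  have HN: "poly (hermite N) (1 / z) = 2 ^ N * Gamma (1 / 2) * ?B"
    using hermite_eq_hyp1F1[of N "1 / z"] unfolding w .
  have "(of_nat M :: complex) = of_nat N - 1" "(1 - of_nat M :: complex) = 2 - of_nat N"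
    "- (of_nat N - 1) = (1 - of_nat N :: complex)"
    by (simp_all add: M)
  then have HM: "poly (hermite M) (1 / z) = 2 ^ M * Gamma (1 / 2) * ?A"
    using hermite_eq_hyp1F1[of M "1 / z"] unfolding w by (simp only:)
  have "moment_gf (hermite N) z
      = 1 / (of_nat N * z) * (2 * of_nat N * (2 ^ M * Gamma (1 / 2) * ?A) / (2 ^ N * Gamma (1 / 2) * ?B))"
    unfolding moment_gf_log_deriv[OF degree_hermite assms(1,3,2)] HN
    unfolding M pderiv_hermite_Suc poly_smult unfolding M[symmetric] HM ..
  also have "\<dots> = (2 * 2 ^ M * (of_nat N * Gamma (1 / 2))) / (2 ^ N * (of_nat N * Gamma (1 / 2))) * (1 / z * (?A / ?B))"
    by (simp only: times_divide_times_eq mult_1_left mult_1_right mult_ac)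
  also have "(2 * 2 ^ M * (of_nat N * Gamma (1 / 2))) / (2 ^ N * (of_nat N * Gamma (1 / 2))) = (1 :: complex)"
    using G assms(1) by (simp add: M del: of_nat_Suc)
  finally show ?thesis by simp
qed

text \<open>The first conjunct shows that the series behind \<open>moment_gf\<close> converges to
  the finite sum over the zeros, so that its \<open>suminf\<close> is a true limit; the degree
  lemmas make this applicable to every family.\<close>

theorem mainTheorem3:
  fixes N :: nat and z :: complex
  assumes "N \<ge> 1" and "0 < cmod z" and "cmod z < 1"
  shows
    "(\<forall>P. degree P = N \<longrightarrow> cmod z * max_zero_norm P < 1 \<longrightarrow>
        summable (\<lambda>r. mean_power P r * z ^ r) \<and>
        moment_gf P z = 1 / of_nat N * (\<Sum>x\<in>#proots P. 1 / (1 - z * x)))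
     \<and>
     (\<forall>\<alpha> \<beta> :: real. \<alpha> > -1 \<longrightarrow> \<beta> > -1 \<longrightarrow>
        cmod z * max_zero_norm (jacobi (of_real \<alpha>) (of_real \<beta>) N) < 1 \<longrightarrow>
        moment_gf (jacobi (of_real \<alpha>) (of_real \<beta>) N) z =
          (of_nat N + of_real \<alpha> + of_real \<beta> + 1) / (2 * (of_real \<alpha> + 1)) * (1 / z) *
          (hyp2F1 (- of_nat N + 1) (of_nat N + of_real \<alpha> + of_real \<beta> + 2) (of_real \<alpha> + 2) ((z - 1) / (2 * z)) /
           hyp2F1 (- of_nat N) (of_nat N + of_real \<alpha> + of_real \<beta> + 1) (of_real \<alpha> + 1) ((z - 1) / (2 * z))))
     \<and>
     (cmod z * max_zero_norm (chebyshev_T N) < 1 \<longrightarrow>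
        moment_gf (chebyshev_T N) z =
          1 / csqrt (1 - z\<^sup>2) * tanh (of_nat N * ln (z / (1 - csqrt (1 - z\<^sup>2)))))
     \<and>
     (cmod z * max_zero_norm (chebyshev_U N) < 1 \<longrightarrow>
        moment_gf (chebyshev_U N) z =
          1 / csqrt (1 - z\<^sup>2) *
          ((1 + 1 / of_nat N) * coth ((of_nat N + 1) * ln (z / (1 - csqrt (1 - z\<^sup>2))))
           - 1 / of_nat N * (1 / csqrt (1 - z\<^sup>2))))
     \<and>
     (\<forall>\<alpha> :: real. \<alpha> > -1 \<longrightarrow>
        cmod z * max_zero_norm (laguerre (of_real \<alpha>) N) < 1 \<longrightarrow>
        moment_gf (laguerre (of_real \<alpha>) N) z =
          1 - hyp1F1 (- of_nat N + 1) (of_real \<alpha> + 1) (1 / z) / hyp1F1 (- of_nat N) (of_real \<alpha> + 1) (1 / z))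
     \<and>
     (cmod z * max_zero_norm (hermite N) < 1 \<longrightarrow>
        moment_gf (hermite N) z =
          1 / z *
          ((hyp1F1 (- (of_nat N - 1) / 2) (1 / 2) (1 / z\<^sup>2) * rGamma ((2 - of_nat N) / 2)
            - 2 / z * hyp1F1 ((2 - of_nat N) / 2) (3 / 2) (1 / z\<^sup>2) * rGamma ((1 - of_nat N) / 2)) /
           (hyp1F1 (- of_nat N / 2) (1 / 2) (1 / z\<^sup>2) * rGamma ((1 - of_nat N) / 2)
            - 2 / z * hyp1F1 ((1 - of_nat N) / 2) (3 / 2) (1 / z\<^sup>2) * rGamma (- of_nat N / 2))))"
proof -
  have z: "z \<noteq> 0" using assms(2) by auto
  show ?thesis
  proof (intro conjI allI impI)
    fix P :: "complex poly"
    assume P: "degree P = N" "cmod z * max_zero_norm P < 1"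
    note sums = moment_gf_sums[OF P(1) assms(1) P(2)]
    show "summable (\<lambda>r. mean_power P r * z ^ r)"
      using sums by (rule sums_summable)
    show "moment_gf P z = 1 / of_nat N * (\<Sum>x\<in>#proots P. 1 / (1 - z * x))"
      unfolding moment_gf_def using sums by (rule sums_unique[symmetric])
  qed (fact moment_gf_jacobi[OF assms(1) z] moment_gf_chebyshev_T[OF assms(1) z assms(3)]
      moment_gf_chebyshev_U[OF assms(1) z assms(3)] moment_gf_laguerre[OF assms(1) z]
      moment_gf_hermite[OF assms(1) z])+
qed

end
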